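(* For every integer $n\ge 1$, $\mu_{\mathrm{int}}(\mathrm{Tr}(n))\le \left\lceil \frac{\Delta(\mathrm{Tr}(n))}{3}\right\rceil$, where $\mathrm{Tr}(n)$ is the $n$-th iterated triangulation and $\Delta$ denotes maximum degree.
   Context: Graphs are finite and simple. The $n$-th iterated triangulation $\mathrm{Tr}(n)$ is the plane graph defined as follows: $\mathrm{Tr}(0)$ is $K_3$ (embedded in the plane), and for each $i\ge 0$, $\mathrm{Tr}(i+1)$ is obtained from $\mathrm{Tr}(i)$ by adding a new vertex $v_f$ in the interior of each inner (bounded) face $f$ of $\mathrm{Tr}(i)$ and joining $v_f$ to each of the three vertices on the boundary of $f$. An improper interval coloring of a graph $G$ is an assignment of colors (natural numbers) to the edges of $G$, not necessarily proper, such that for every vertex $v$ the set of colors on the edges incident with $v$ is an integral interval (a set of consecutive integers). It is $k$-improper if at most $k$ edges with the same color all share a common endpoint, i.e. at each vertex each color appears on at most $k$ incident edges. The interval coloring impropriety $\mu_{\mathrm{int}}(G)$ is the smallest positive integer $k$ such that $G$ has a $k$-improper interval coloring. *)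

theory Defs
  imports Complex_Main
begin

section \<open>Finite simple graphs and interval coloring impropriety\<close>

text \<open>A graph is a pair of a vertex set and a set of edges, each edge being the two-element set
  of its end vertices.\<close>

type_synonym 'v graph = "'v set \<times> 'v set set"

abbreviation verts :: "'v graph \<Rightarrow> 'v set" where
  "verts G \<equiv> fst G"

abbreviation edges :: "'v graph \<Rightarrow> 'v set set" where
  "edges G \<equiv> snd G"

definition finite_simple_graph :: "'v graph \<Rightarrow> bool" where
  "finite_simple_graph G \<longleftrightarrow>
     finite (verts G) \<and> (\<forall>e\<in>edges G. e \<subseteq> verts G \<and> card e = 2)"

definition incident_edges :: "'v graph \<Rightarrow> 'v \<Rightarrow> 'v set set" where
  "incident_edges G v = {e \<in> edges G. v \<in> e}"

definition degree :: "'v graph \<Rightarrow> 'v \<Rightarrow> nat" where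
  "degree G v = card (incident_edges G v)"

definition max_degree :: "'v graph \<Rightarrow> nat" where
  "max_degree G = Max (degree G ` verts G)"

text \<open>The coloring need not be proper. The interval may be empty (\<open>a > b\<close>), which only
  happens at isolated vertices.\<close>

definition improper_interval_coloring :: "'v graph \<Rightarrow> ('v set \<Rightarrow> nat) \<Rightarrow> bool" where
  "improper_interval_coloring G c \<longleftrightarrow>
     (\<forall>v\<in>verts G. \<exists>a b. c ` incident_edges G v = {a..b})"

definition k_improper_interval_coloring ::
    "'v graph \<Rightarrow> nat \<Rightarrow> ('v set \<Rightarrow> nat) \<Rightarrow> bool" where
  "k_improper_interval_coloring G k c \<longleftrightarrow>
     improper_interval_coloring G c \<and>
     (\<forall>v\<in>verts G. \<forall>x. card {e \<in> incident_edges G v. c e = x} \<le> k)"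

definition mu_int :: "'v graph \<Rightarrow> nat" where
  "mu_int G = (LEAST k. k \<ge> 1 \<and> (\<exists>c. k_improper_interval_coloring G k c))"

text \<open>The minimum in \<^const>\<open>mu_int\<close> is over a nonempty set, since a constant coloring is
  \<open>k\<close>-improper for all large \<open>k\<close>.\<close>

lemma finite_incident_edges:
  assumes "finite_simple_graph G"
  shows "finite (incident_edges G v)"
proof -
  have "edges G \<subseteq> Pow (verts G)" "finite (verts G)"
    using assms by (auto simp: finite_simple_graph_def)
  then have "finite (edges G)"
    using finite_subset by blast
  then show ?thesis
    by (simp add: incident_edges_def)
qed

lemma k_improper_interval_coloring_exists:
  assumes "finite_simple_graph G"
  shows "\<exists>k\<ge>1. \<exists>c. k_improper_interval_coloring G k c"
proof -
  let ?k = "Suc (\<Sum>v\<in>verts G. degree G v)"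
  let ?c = "\<lambda>_. 0 :: nat"
  have fin: "finite (verts G)"
    using assms by (simp add: finite_simple_graph_def)
  have "\<exists>a b. ?c ` S = {a..b}" for S :: "'a set set"
  proof (cases "S = {}")
    case True
    then have "?c ` S = {1..0}" by simp
    then show ?thesis by blast
  next
    case False
    then have "?c ` S = {0..0}" by auto
    then show ?thesis by blast
  qed
  moreover have "card {e \<in> incident_edges G v. ?c e = x} \<le> ?k" if "v \<in> verts G" for v x
  proof -
    have "card {e \<in> incident_edges G v. ?c e = x} \<le> degree G v"
      unfolding degree_def using finite_incident_edges[OF assms]
      by (intro card_mono) auto
    also have "\<dots> \<le> (\<Sum>v\<in>verts G. degree G v)"
      using fin that by (intro member_le_sum) auto
    finally show ?thesis by simp
  qed
  ultimately have "k_improper_interval_coloring G ?k ?c"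
    unfolding k_improper_interval_coloring_def improper_interval_coloring_def by blast
  then show ?thesis
    by (intro exI[of _ ?k]) auto
qed

lemma mu_int_attained:
  assumes "finite_simple_graph G"
  shows "mu_int G \<ge> 1 \<and> (\<exists>c. k_improper_interval_coloring G (mu_int G) c)"
  unfolding mu_int_def by (rule LeastI_ex) (use k_improper_interval_coloring_exists[OF assms] in blast)


section \<open>Iterated triangulations\<close>

text \<open>All bounded faces of an iterated triangulation are triangles, so the plane embedding is
  carried along combinatorially as the set of inner faces, a face being recorded by an ordered
  triple of its three boundary vertices. Placing a vertex \<open>v\<close> inside the face \<open>(a, b, c)\<close> and
  joining it to \<open>a\<close>, \<open>b\<close> and \<open>c\<close> replaces that face by three others. The new vertex is named
  \<open>Center a b c\<close>, so different triples give different new vertices. The lemmas below show that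
  this name is fresh and that no face is recorded under two orderings. The outer face, also bounded
  by the three corners, is not listed and is never subdivided.\<close>

datatype tr_vertex = Corner nat | Center tr_vertex tr_vertex tr_vertex

primrec tr_faces :: "nat \<Rightarrow> (tr_vertex \<times> tr_vertex \<times> tr_vertex) set" where
  "tr_faces 0 = {(Corner 0, Corner 1, Corner 2)}"
| "tr_faces (Suc n) =
     (\<Union>(a, b, c)\<in>tr_faces n. {(a, b, Center a b c), (b, c, Center a b c), (c, a, Center a b c)})"

primrec tr_verts :: "nat \<Rightarrow> tr_vertex set" where
  "tr_verts 0 = {Corner 0, Corner 1, Corner 2}"
| "tr_verts (Suc n) = tr_verts n \<union> (\<Union>(a, b, c)\<in>tr_faces n. {Center a b c})"

primrec tr_edges :: "nat \<Rightarrow> tr_vertex set set" where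
  "tr_edges 0 = {{Corner 0, Corner 1}, {Corner 1, Corner 2}, {Corner 0, Corner 2}}"
| "tr_edges (Suc n) = tr_edges n \<union>
     (\<Union>(a, b, c)\<in>tr_faces n. {{a, Center a b c}, {b, Center a b c}, {c, Center a b c}})"

definition Tr :: "nat \<Rightarrow> tr_vertex graph" where
  "Tr n = (tr_verts n, tr_edges n)"

lemma finite_tr_faces: "finite (tr_faces n)"
  by (induction n) auto

lemma finite_tr_verts: "finite (tr_verts n)"
  by (induction n) (auto simp: finite_tr_faces)

lemma tr_faces_are_triangles:
  assumes "(a, b, c) \<in> tr_faces n"
  shows "a \<in> tr_verts n" "b \<in> tr_verts n" "c \<in> tr_verts n"
    and "{a, b} \<in> tr_edges n" "{b, c} \<in> tr_edges n" "{a, c} \<in> tr_edges n"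
proof -
  have "a \<in> tr_verts n \<and> b \<in> tr_verts n \<and> c \<in> tr_verts n \<and>
      {a, b} \<in> tr_edges n \<and> {b, c} \<in> tr_edges n \<and> {a, c} \<in> tr_edges n"
    using assms
  proof (induction n arbitrary: a b c)
    case 0
    then show ?case by auto
  next
    case (Suc n)
    from Suc.prems obtain p q r where pqr: "(p, q, r) \<in> tr_faces n"
      and abc: "(a, b, c) = (p, q, Center p q r) \<or> (a, b, c) = (q, r, Center p q r) \<or>
        (a, b, c) = (r, p, Center p q r)"
      by auto
    define v where "v = Center p q r"
    have "v \<in> tr_verts (Suc n)"
      unfolding v_def using pqr by force
    moreover have "{p, v} \<in> tr_edges (Suc n)" "{q, v} \<in> tr_edges (Suc n)"
      "{r, v} \<in> tr_edges (Suc n)"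
      unfolding v_def using pqr by force+
    moreover have "p \<in> tr_verts (Suc n)" "q \<in> tr_verts (Suc n)" "r \<in> tr_verts (Suc n)"
      "{p, q} \<in> tr_edges (Suc n)" "{q, r} \<in> tr_edges (Suc n)" "{r, p} \<in> tr_edges (Suc n)"
      using Suc.IH[OF pqr] by (simp_all add: insert_commute)
    moreover have "(a, b, c) = (p, q, v) \<or> (a, b, c) = (q, r, v) \<or> (a, b, c) = (r, p, v)"
      using abc by (simp add: v_def)
    ultimately show ?case
      by (elim disjE) (simp_all del: tr_verts.simps tr_edges.simps)
  qed
  then show "a \<in> tr_verts n" "b \<in> tr_verts n" "c \<in> tr_verts n"
    "{a, b} \<in> tr_edges n" "{b, c} \<in> tr_edges n" "{a, c} \<in> tr_edges n"
    by blast+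
qed

primrec tr_level :: "tr_vertex \<Rightarrow> nat" where
  "tr_level (Corner i) = 0"
| "tr_level (Center a b c) = Suc (max (tr_level a) (max (tr_level b) (tr_level c)))"

lemma tr_level_le: "v \<in> tr_verts n \<Longrightarrow> tr_level v \<le> n"
proof (induction n arbitrary: v)
  case (Suc n)
  have "tr_level a \<le> n \<and> tr_level b \<le> n \<and> tr_level c \<le> n" if "(a, b, c) \<in> tr_faces n" for a b c
    using tr_faces_are_triangles(1-3)[OF that] Suc.IH by blast
  then show ?case
    using Suc.prems Suc.IH by (fastforce simp: le_SucI)
qed auto

lemma tr_level_face: "(a, b, c) \<in> tr_faces n \<Longrightarrow> tr_level c = n \<or> n = 0"
proof (induction n arbitrary: a b c)
  case (Suc n)
  from Suc.prems obtain p q r where pqr: "(p, q, r) \<in> tr_faces n" and c: "c = Center p q r"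
    by auto
  have "tr_level p \<le> n" "tr_level q \<le> n" "tr_level r \<le> n"
    using tr_faces_are_triangles[OF pqr] tr_level_le by blast+
  then show ?case
    using Suc.IH[OF pqr] c by auto
qed simp

lemma tr_level_center:
  assumes "(a, b, c) \<in> tr_faces n"
  shows "tr_level (Center a b c) = Suc n"
proof -
  have "tr_level a \<le> n" "tr_level b \<le> n" "tr_level c \<le> n"
    using tr_faces_are_triangles(1-3)[OF assms] tr_level_le by blast+
  then show ?thesis
    using tr_level_face[OF assms] by auto
qed

lemma tr_center_fresh:
  assumes "(a, b, c) \<in> tr_faces n"
  shows "Center a b c \<notin> tr_verts n"
  using tr_level_center[OF assms] tr_level_le[of "Center a b c" n] by linarith

lemma tr_face_distinct: "(a, b, c) \<in> tr_faces n \<Longrightarrow> a \<noteq> b \<and> b \<noteq> c \<and> a \<noteq> c"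
proof (induction n arbitrary: a b c)
  case (Suc n)
  from Suc.prems obtain p q r where pqr: "(p, q, r) \<in> tr_faces n"
    and "(a, b, c) = (p, q, Center p q r) \<or> (a, b, c) = (q, r, Center p q r) \<or>
      (a, b, c) = (r, p, Center p q r)"
    by auto
  then show ?case
    using Suc.IH[OF pqr] tr_center_fresh[OF pqr] tr_faces_are_triangles(1-3)[OF pqr] by auto
qed simp

lemma tr_face_unique_ordering:
  assumes "(a, b, c) \<in> tr_faces n" "(a', b', c') \<in> tr_faces n" "{a, b, c} = {a', b', c'}"
  shows "(a, b, c) = (a', b', c')"
proof (cases n)
  case 0
  then show ?thesis using assms by simp
next
  case (Suc m)
  obtain p q r where pqr: "(p, q, r) \<in> tr_faces m"
    and abc: "(a, b, c) = (p, q, Center p q r) \<or> (a, b, c) = (q, r, Center p q r) \<or>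
      (a, b, c) = (r, p, Center p q r)"
    using assms(1) Suc by auto
  obtain p' q' r' where pqr': "(p', q', r') \<in> tr_faces m"
    and abc': "(a', b', c') = (p', q', Center p' q' r') \<or> (a', b', c') = (q', r', Center p' q' r') \<or>
      (a', b', c') = (r', p', Center p' q' r')"
    using assms(2) Suc by auto
  have old: "{p, q, r} \<subseteq> tr_verts m" "{p', q', r'} \<subseteq> tr_verts m"
    using tr_faces_are_triangles(1-3)[OF pqr] tr_faces_are_triangles(1-3)[OF pqr'] by auto
  have "c \<in> {a', b', c'}" using assms(3) by blast
  then have "c = c'"
    using abc abc' old tr_center_fresh[OF pqr] by auto
  then have eq: "p = p'" "q = q'" "r = r'"
    using abc abc' by auto
  have "{a, b} = {a', b'}"
    using assms(3) \<open>c = c'\<close> tr_face_distinct[OF assms(1)] tr_face_distinct[OF assms(2)] by blast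
  then show ?thesis
    using abc abc' eq tr_face_distinct[OF pqr] by (auto simp: doubleton_eq_iff)
qed

lemma finite_simple_graph_Tr: "finite_simple_graph (Tr n)"
proof -
  have "\<forall>e\<in>tr_edges n. e \<subseteq> tr_verts n \<and> card e = 2"
  proof (induction n)
    case 0
    then show ?case by simp
  next
    case (Suc n)
    have "e \<subseteq> tr_verts (Suc n) \<and> card e = 2" if e: "e \<in> tr_edges (Suc n)" for e
    proof (cases "e \<in> tr_edges n")
      case True
      then show ?thesis using Suc.IH by auto
    next
      case False
      then obtain a b c x where abc: "(a, b, c) \<in> tr_faces n" and x: "x \<in> {a, b, c}"
        and ex: "e = {x, Center a b c}"
        using e by fastforce
      have "x \<in> tr_verts n"
        using tr_faces_are_triangles(1-3)[OF abc] x by auto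
      moreover from this have "x \<noteq> Center a b c"
        using tr_center_fresh[OF abc] by auto
      moreover have "Center a b c \<in> tr_verts (Suc n)"
        using abc by force
      ultimately show ?thesis
        using ex by auto
    qed
    then show ?case by blast
  qed
  then show ?thesis
    by (simp add: finite_simple_graph_def Tr_def finite_tr_verts)
qed

end

theory Submission imports Defs
begin

text \<open>
  Every iterated triangulation has a proper vertex coloring with the four colors 0, 1, 2, 3: the
  corners of a face carry three different colors, and a vertex placed inside the face receives the
  fourth. Split the six pairs of colors into the three perfect matchings of the complete graph on
  the colors, and give an edge the matching to which its two end colors belong. This colors the
  edges with 1, 2, 3, every face sees all three edge colors, and an edge drawn from a corner \<open>x\<close> of
  a face to its center has the color of the side opposite to \<open>x\<close>.

  For a vertex \<open>x\<close> of \<open>Tr n\<close> let \<open>T\<close> be the number of inner faces at \<open>x\<close>, and for an edge color \<open>k\<close>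
  let \<open>d\<close> be the number of edges of color \<open>k\<close> at \<open>x\<close> and \<open>N\<close> the number of inner faces at \<open>x\<close> whose
  side opposite to \<open>x\<close> has color \<open>k\<close>. One subdivision replaces \<open>d\<close> by \<open>d + N\<close>, \<open>T\<close> by \<open>2 T\<close> and
  \<open>N\<close> by \<open>T - N\<close>. The last rule keeps the colors balanced: two subdivisions
  add exactly \<open>T\<close> edges of each color. A vertex just placed starts with
  \<open>d = N = 1\<close> and \<open>T = 3\<close>. Together with \<open>2 T \<le> 3 * 2 ^ n\<close> these rules give
  \<open>1 \<le> d \<le> 2 ^ (n - 1)\<close> in \<open>Tr n\<close> for \<open>n \<ge> 1\<close>, so that all three colors occur at every vertex and the
  coloring is \<open>2 ^ (n - 1)\<close>-improper. The vertex placed first has degree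
  \<open>3 * 2 ^ (n - 1)\<close>, so this impropriety is at most a third of the maximum degree.

  Lemma \<open>balance_invariant\<close> carries the counting argument, and the three recurrences come from the
  two summation rules over the faces and edges of a subdivision.
\<close>

section \<open>The four vertex colors and the three edge colors\<close>

text \<open>The four colors add up to 6, so the center of a face gets the one that its corners miss.\<close>

primrec vcolor :: "tr_vertex \<Rightarrow> nat" where
  "vcolor (Corner i) = i"
| "vcolor (Center a b c) = 6 - (vcolor a + vcolor b + vcolor c)"

text \<open>Complementary pairs of colors have sums \<open>s\<close> and \<open>6 - s\<close>: the matchings
  \<open>01|23\<close>, \<open>02|13\<close>, \<open>03|12\<close> receive the edge colors 1, 2, 3.\<close>

definition ecolor :: "tr_vertex set \<Rightarrow> nat" where
  "ecolor e = min (sum vcolor e) (6 - sum vcolor e)"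

lemma ecolor_pair: "x \<noteq> y \<Longrightarrow> ecolor {x, y} = min (vcolor x + vcolor y) (6 - (vcolor x + vcolor y))"
  by (simp add: ecolor_def)

definition rainbow :: "tr_vertex \<Rightarrow> tr_vertex \<Rightarrow> tr_vertex \<Rightarrow> bool" where
  "rainbow a b c \<longleftrightarrow> distinct [vcolor a, vcolor b, vcolor c] \<and>
     vcolor a \<le> 3 \<and> vcolor b \<le> 3 \<and> vcolor c \<le> 3"

lemma fourth_color:
  fixes i j k :: nat
  assumes "distinct [i, j, k]" "i \<le> 3" "j \<le> 3" "k \<le> 3" "l = 6 - (i + j + k)"
  shows "distinct [i, j, k, l]" "l \<le> 3" "i + j + k + l = 6"
proof -
  have "i \<in> {0,1,2,3}" "j \<in> {0,1,2,3}" "k \<in> {0,1,2,3}"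
    using assms by auto
  then have "distinct [i, j, k, l] \<and> l \<le> 3 \<and> i + j + k + l = 6"
    using assms(1,5) by (elim insertE emptyE) simp_all
  then show "distinct [i, j, k, l]" "l \<le> 3" "i + j + k + l = 6" by blast+
qed

lemma rainbow_vcolors:
  assumes "rainbow a b c" "v = Center a b c"
  shows "distinct [vcolor a, vcolor b, vcolor c, vcolor v]" "vcolor v \<le> 3"
    "vcolor a + vcolor b + vcolor c + vcolor v = 6"
  using fourth_color[of "vcolor a" "vcolor b" "vcolor c" "vcolor v"] assms
  by (auto simp: rainbow_def)

lemma rainbow_center:
  assumes "rainbow a b c"
  shows "rainbow a b (Center a b c)" "rainbow b c (Center a b c)" "rainbow c a (Center a b c)"
  using rainbow_vcolors[OF assms refl] assms unfolding rainbow_def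
  by (auto simp del: vcolor.simps)

lemma rainbow_face: "(a, b, c) \<in> tr_faces n \<Longrightarrow> rainbow a b c"
proof (induction n arbitrary: a b c)
  case 0
  then show ?case by (simp add: rainbow_def)
next
  case (Suc n)
  then show ?case using rainbow_center by fastforce
qed

text \<open>The center of a face sees the three remaining vertex colors, hence each edge color once.\<close>

lemma rainbow_star_ecolors:
  assumes "rainbow a b c" "v = Center a b c" "k \<in> {1..3}"
  shows "of_bool (ecolor {a, v} = k) + of_bool (ecolor {b, v} = k) + of_bool (ecolor {c, v} = k)
    = (1 :: nat)"
proof -
  have d: "distinct [vcolor a, vcolor b, vcolor c, vcolor v]"
    and le: "vcolor a \<le> 3" "vcolor b \<le> 3" "vcolor c \<le> 3"
    and v: "vcolor v = 6 - (vcolor a + vcolor b + vcolor c)"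
    using assms rainbow_vcolors(1)[OF assms(1,2)] by (auto simp: rainbow_def)
  have ne: "a \<noteq> v" "b \<noteq> v" "c \<noteq> v" using d by auto
  have "vcolor a \<in> {0,1,2,3}" "vcolor b \<in> {0,1,2,3}" "vcolor c \<in> {0,1,2,3}" "k \<in> {1,2,3}"
    using le assms(3) by auto
  then show ?thesis
    using d unfolding ecolor_pair[OF ne(1)] ecolor_pair[OF ne(2)] ecolor_pair[OF ne(3)] v
    by (elim insertE emptyE) simp_all
qed

text \<open>The edge from a corner to the center and the opposite side have complementary end colors.\<close>

lemma rainbow_opposite:
  assumes "rainbow a b c" "v = Center a b c"
  shows "ecolor {a, v} = ecolor {b, c}" "ecolor {b, v} = ecolor {a, c}" "ecolor {c, v} = ecolor {a, b}"
proof -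
  note v = rainbow_vcolors[OF assms]
  have ne: "a \<noteq> v" "b \<noteq> v" "c \<noteq> v" "b \<noteq> c" "a \<noteq> c" "a \<noteq> b" using v(1) by auto
  show "ecolor {a, v} = ecolor {b, c}" "ecolor {b, v} = ecolor {a, c}" "ecolor {c, v} = ecolor {a, b}"
    unfolding ne[THEN ecolor_pair] using v(3) by linarith+
qed

lemma ecolor_edge: "e \<in> tr_edges n \<Longrightarrow> ecolor e \<in> {1..3}"
proof (induction n)
  case 0
  then show ?case by (auto simp: ecolor_def)
next
  case (Suc n)
  have "ecolor {x, Center a b c} \<in> {1..3}"
    if abc: "(a, b, c) \<in> tr_faces n" and x: "x \<in> {a, b, c}" for a b c x
  proof -
    have "vcolor x \<noteq> vcolor (Center a b c)" "vcolor x \<le> 3" "vcolor (Center a b c) \<le> 3"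
      using rainbow_center[OF rainbow_face[OF abc]] x unfolding rainbow_def by auto
    moreover from this have "x \<noteq> Center a b c" by metis
    ultimately show ?thesis
      unfolding ecolor_pair[OF \<open>x \<noteq> Center a b c\<close>] by (simp add: min_def) linarith
  qed
  with Suc show ?case by fastforce
qed

section \<open>Summation over a subdivision\<close>

lemma sum_tr_faces_Suc:
  fixes g :: "tr_vertex \<times> tr_vertex \<times> tr_vertex \<Rightarrow> nat"
  shows "sum g (tr_faces (Suc n)) = (\<Sum>(a, b, c)\<in>tr_faces n.
    g (a, b, Center a b c) + g (b, c, Center a b c) + g (c, a, Center a b c))"
proof -
  define S where "S = (\<lambda>(a, b, c). {(a, b, Center a b c), (b, c, Center a b c), (c, a, Center a b c)})"
  have "sum g (\<Union> (S ` tr_faces n)) = (\<Sum>f\<in>tr_faces n. sum g (S f))"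
    by (rule sum.UNION_disjoint) (auto simp: finite_tr_faces S_def)
  also have "\<dots> = (\<Sum>(a, b, c)\<in>tr_faces n.
    g (a, b, Center a b c) + g (b, c, Center a b c) + g (c, a, Center a b c))"
    using tr_face_distinct by (intro sum.cong) (force simp: S_def)+
  finally show ?thesis by (simp add: S_def)
qed

lemma finite_tr_edges: "finite (tr_edges n)"
  by (induction n) (auto simp: finite_tr_faces)

text \<open>Each new edge has the center of its face as its only new end, so the stars placed in different
  faces share no edge with each other or with the old graph.\<close>

lemma sum_tr_edges_Suc:
  fixes g :: "tr_vertex set \<Rightarrow> nat"
  shows "sum g (tr_edges (Suc n)) = sum g (tr_edges n) + (\<Sum>(a, b, c)\<in>tr_faces n.
    g {a, Center a b c} + g {b, Center a b c} + g {c, Center a b c})"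
proof -
  define S where "S = (\<lambda>(a, b, c). {{a, Center a b c}, {b, Center a b c}, {c, Center a b c}})"
  have old: "{a, b, c} \<subseteq> tr_verts n" if "(a, b, c) \<in> tr_faces n" for a b c
    using tr_faces_are_triangles(1-3)[OF that] by simp
  have new: "e \<inter> - tr_verts n = {Center a b c}"
    if "(a, b, c) \<in> tr_faces n" "e \<in> S (a, b, c)" for a b c e
    using old[OF that(1)] tr_center_fresh[OF that(1)] that(2) by (auto simp: S_def)
  have edge_old: "e \<subseteq> tr_verts n" if "e \<in> tr_edges n" for e
    using finite_simple_graph_Tr[of n] that by (simp add: finite_simple_graph_def Tr_def)
  have "tr_edges n \<inter> \<Union> (S ` tr_faces n) = {}"
    using new edge_old by fastforce
  moreover have "tr_edges (Suc n) = tr_edges n \<union> \<Union> (S ` tr_faces n)"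
    by (simp add: S_def)
  ultimately have "sum g (tr_edges (Suc n)) = sum g (tr_edges n) + sum g (\<Union> (S ` tr_faces n))"
    by (simp del: tr_edges.simps
        add: sum.union_disjoint finite_tr_edges finite_tr_faces S_def split: prod.split)
  also have "sum g (\<Union> (S ` tr_faces n)) = (\<Sum>f\<in>tr_faces n. sum g (S f))"
  proof (rule sum.UNION_disjoint)
    show "\<forall>f\<in>tr_faces n. \<forall>f'\<in>tr_faces n. f \<noteq> f' \<longrightarrow> S f \<inter> S f' = {}"
      using new by (metis disjoint_iff prod_cases3 singleton_inject tr_vertex.inject(2))
  qed (auto simp: finite_tr_faces S_def)
  also have "\<dots> = (\<Sum>(a, b, c)\<in>tr_faces n.
    g {a, Center a b c} + g {b, Center a b c} + g {c, Center a b c})"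
  proof (rule sum.cong[OF refl], clarify)
    fix a b c assume f: "(a, b, c) \<in> tr_faces n"
    have "{a, Center a b c} \<noteq> {b, Center a b c}" "{a, Center a b c} \<noteq> {c, Center a b c}"
      "{b, Center a b c} \<noteq> {c, Center a b c}"
      using tr_face_distinct[OF f] by (auto simp: doubleton_eq_iff)
    then show "sum g (S (a, b, c)) = g {a, Center a b c} + g {b, Center a b c} + g {c, Center a b c}"
      by (simp add: S_def)
  qed
  finally show ?thesis .
qed

section \<open>Counting edges and faces at a vertex\<close>

definition color_degree :: "nat \<Rightarrow> tr_vertex \<Rightarrow> nat \<Rightarrow> nat" where
  "color_degree n x k = (\<Sum>e\<in>tr_edges n. of_bool (x \<in> e \<and> ecolor e = k))"

definition face_degree :: "nat \<Rightarrow> tr_vertex \<Rightarrow> nat" where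
  "face_degree n x = (\<Sum>(a, b, c)\<in>tr_faces n. of_bool (x \<in> {a, b, c}))"

text \<open>The side of a face opposite to \<open>x\<close> has the color of the edge from \<open>x\<close> to the center.
  Recording that edge instead treats the three corners alike.\<close>

definition opposite_degree :: "nat \<Rightarrow> tr_vertex \<Rightarrow> nat \<Rightarrow> nat" where
  "opposite_degree n x k =
     (\<Sum>(a, b, c)\<in>tr_faces n. of_bool (x \<in> {a, b, c} \<and> ecolor {x, Center a b c} = k))"

lemma color_degree_Suc:
  assumes "x \<in> tr_verts n"
  shows "color_degree (Suc n) x k = color_degree n x k + opposite_degree n x k"
proof -
  have "of_bool (x \<in> {a, v} \<and> ecolor {a, v} = k) + of_bool (x \<in> {b, v} \<and> ecolor {b, v} = k)
      + of_bool (x \<in> {c, v} \<and> ecolor {c, v} = k)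
      = (of_bool (x \<in> {a, b, c} \<and> ecolor {x, v} = k) :: nat)"
    if f: "(a, b, c) \<in> tr_faces n" and v: "v = Center a b c" for a b c v
    using tr_face_distinct[OF f] tr_center_fresh[OF f] assms v by auto
  then show ?thesis
    unfolding color_degree_def opposite_degree_def sum_tr_edges_Suc
    by (auto intro!: sum.cong)
qed

lemma face_degree_Suc:
  assumes "x \<in> tr_verts n"
  shows "face_degree (Suc n) x = 2 * face_degree n x"
proof -
  have "of_bool (x \<in> {a, b, v}) + of_bool (x \<in> {b, c, v}) + of_bool (x \<in> {c, a, v})
      = (2 * of_bool (x \<in> {a, b, c}) :: nat)"
    if f: "(a, b, c) \<in> tr_faces n" and v: "v = Center a b c" for a b c v
    using tr_face_distinct[OF f] tr_center_fresh[OF f] assms v by auto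
  then show ?thesis
    unfolding face_degree_def sum_tr_faces_Suc sum_distrib_left
    by (auto intro!: sum.cong)
qed

text \<open>A face at \<open>x\<close> with opposite side of color \<open>k\<close> is cut into two faces at \<open>x\<close> whose opposite sides
  have the two other colors; a face whose opposite side has another color yields exactly one
  face with opposite color \<open>k\<close>.\<close>

lemma opposite_degree_Suc:
  assumes "x \<in> tr_verts n" "k \<in> {1..3}"
  shows "opposite_degree (Suc n) x k + opposite_degree n x k = face_degree n x"
proof -
  have "of_bool (x \<in> {a, b, v} \<and> ecolor {x, Center a b v} = k)
      + of_bool (x \<in> {b, c, v} \<and> ecolor {x, Center b c v} = k)
      + of_bool (x \<in> {c, a, v} \<and> ecolor {x, Center c a v} = k)
      + of_bool (x \<in> {a, b, c} \<and> ecolor {x, v} = k) = (of_bool (x \<in> {a, b, c}) :: nat)"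
    if f: "(a, b, c) \<in> tr_faces n" and v: "v = Center a b c" for a b c v
  proof -
    note r = rainbow_face[OF f]
    note r' = rainbow_center[OF r, folded v]
    note star = rainbow_star_ecolors[OF r v assms(2)]
    note opp = rainbow_opposite[OF r v]
    note o1 = rainbow_opposite[OF r'(1) refl]
    note o2 = rainbow_opposite[OF r'(2) refl]
    note o3 = rainbow_opposite[OF r'(3) refl]
    have "x \<noteq> v" "a \<noteq> b" "b \<noteq> c" "a \<noteq> c"
      using tr_face_distinct[OF f] tr_center_fresh[OF f] assms v by auto
    then show ?thesis
      using star opp o1 o2 o3 by (auto simp: insert_commute)
  qed
  then show ?thesis
    unfolding opposite_degree_def face_degree_def sum_tr_faces_Suc sum.distrib[symmetric]
    by (auto intro!: sum.cong)
qed

lemma new_vertex_degrees: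
  assumes f: "(p, q, r) \<in> tr_faces n" and x: "x = Center p q r" and k: "k \<in> {1..3}"
  shows "color_degree (Suc n) x k = 1" "opposite_degree (Suc n) x k = 1" "face_degree (Suc n) x = 3"
proof -
  have fresh: "x \<notin> tr_verts n" using tr_center_fresh[OF f] x by simp
  have other: "x \<notin> {a, b, c, Center a b c} \<or> (a, b, c) = (p, q, r)" "x \<notin> {a, b, c}"
    if "(a, b, c) \<in> tr_faces n" for a b c
    using tr_faces_are_triangles(1-3)[OF that] fresh x by auto
  have single: "(\<Sum>t\<in>tr_faces n. g t) = g (p, q, r)"
    if "\<And>a b c. (a, b, c) \<in> tr_faces n \<Longrightarrow> (a, b, c) \<noteq> (p, q, r) \<Longrightarrow> g (a, b, c) = 0" for g :: "_ \<Rightarrow> nat"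
  proof -
    have "sum g (tr_faces n - {(p, q, r)}) = 0"
      by (rule sum.neutral) (use that in \<open>metis DiffE insertI1 prod_cases3\<close>)
    then show ?thesis
      using sum.remove[OF finite_tr_faces f, of g] by simp
  qed
  note star = rainbow_star_ecolors[OF rainbow_face[OF f] x k]
  have old: "(\<Sum>e\<in>tr_edges n. of_bool (x \<in> e \<and> ecolor e = k)) = (0::nat)"
    using finite_simple_graph_Tr[of n] fresh
    by (intro sum.neutral) (auto simp: finite_simple_graph_def Tr_def)
  show "color_degree (Suc n) x k = 1"
    unfolding color_degree_def sum_tr_edges_Suc old
    by (subst single) (use other star x in auto)
  show "face_degree (Suc n) x = 3"
    unfolding face_degree_def sum_tr_faces_Suc
    by (subst single) (use other x in auto)
  note rb = rainbow_center[OF rainbow_face[OF f], folded x]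
  \<comment> \<open>In each of the three new faces the center has the color of the corner of \<open>(p, q, r)\<close> cut off.\<close>
  have "ecolor {x, Center p q x} = ecolor {r, x}" "ecolor {x, Center q r x} = ecolor {p, x}"
    "ecolor {x, Center r p x} = ecolor {q, x}"
    using rainbow_opposite[OF rb(1) refl] rainbow_opposite[OF rb(2) refl]
      rainbow_opposite[OF rb(3) refl] rainbow_opposite[OF rainbow_face[OF f] x]
    by (simp_all add: insert_commute)
  then show "opposite_degree (Suc n) x k = 1"
    unfolding opposite_degree_def sum_tr_faces_Suc
    by (subst single) (use other star x in auto)
qed

section \<open>Balance of the edge coloring\<close>

text \<open>The first two bounds say that after one more subdivision \<open>x\<close> has between 1 and
  \<open>2 ^ n\<close> edges of color \<open>k\<close>. The third is the second bound of the next subdivision in disguise,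
  because two successive opposite degrees add up to the face degree. The last one bounds the growth
  of the third.\<close>

lemma balance_invariant:
  assumes "x \<in> tr_verts n" "k \<in> {1..3}"
  shows "1 \<le> color_degree n x k + opposite_degree n x k \<and>
    color_degree n x k + opposite_degree n x k \<le> 2 ^ n \<and>
    color_degree n x k + face_degree n x \<le> 2 ^ Suc n \<and>
    2 * face_degree n x \<le> 3 * 2 ^ n"
  using assms(1)
proof (induction n)
  case 0
  have "{Corner 0, Corner 1} \<noteq> {Corner 1, Corner 2}" "{Corner 0, Corner 1} \<noteq> {Corner 0, Corner 2}"
    "{Corner 1, Corner 2} \<noteq> {Corner 0, Corner 2}" by (auto simp: doubleton_eq_iff)
  moreover have "k = 1 \<or> k = 2 \<or> k = 3" using assms(2) by auto
  ultimately show ?case using 0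
    by (auto simp: color_degree_def opposite_degree_def face_degree_def ecolor_def)
next
  case (Suc n)
  show ?case
  proof (cases "x \<in> tr_verts n")
    case True
    show ?thesis
      using Suc.IH[OF True] color_degree_Suc[OF True, of k] face_degree_Suc[OF True]
        opposite_degree_Suc[OF True assms(2)] by auto
  next
    case False
    then obtain p q r where f: "(p, q, r) \<in> tr_faces n" "x = Center p q r"
      using Suc.prems by auto
    have "(1::nat) \<le> 2 ^ n" by simp
    then show ?thesis
      unfolding new_vertex_degrees[OF f assms(2)] power_Suc by linarith
  qed
qed

lemma color_degree_bounds:
  assumes "x \<in> tr_verts (Suc n)" "k \<in> {1..3}"
  shows "1 \<le> color_degree (Suc n) x k" "color_degree (Suc n) x k \<le> 2 ^ n"
proof -
  have "1 \<le> color_degree (Suc n) x k \<and> color_degree (Suc n) x k \<le> 2 ^ n"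
  proof (cases "x \<in> tr_verts n")
    case True
    then show ?thesis
      using balance_invariant[OF True assms(2)] color_degree_Suc by simp
  next
    case False
    then obtain p q r where "(p, q, r) \<in> tr_faces n" "x = Center p q r"
      using assms(1) by auto
    then show ?thesis
      using new_vertex_degrees(1)[OF _ _ assms(2)] by simp
  qed
  then show "1 \<le> color_degree (Suc n) x k" "color_degree (Suc n) x k \<le> 2 ^ n" by auto
qed

lemma color_degree_eq_card:
  "color_degree n x k = card {e \<in> incident_edges (Tr n) x. ecolor e = k}"
proof -
  have "{e \<in> incident_edges (Tr n) x. ecolor e = k} = tr_edges n \<inter> {e. x \<in> e \<and> ecolor e = k}"
    by (auto simp: incident_edges_def Tr_def)
  then show ?thesis
    by (simp add: color_degree_def finite_tr_edges)
qed

lemma k_improper_ecolor: "k_improper_interval_coloring (Tr (Suc n)) (2 ^ n) ecolor"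
proof -
  let ?G = "Tr (Suc n)"
  have range: "ecolor e \<in> {1..3}" if "e \<in> incident_edges ?G x" for e x
    using that ecolor_edge[of e "Suc n"] unfolding incident_edges_def Tr_def by simp
  have "ecolor ` incident_edges ?G x = {1..3}" if x: "x \<in> verts ?G" for x
  proof
    show "ecolor ` incident_edges ?G x \<subseteq> {1..3}" using range by blast
    show "{1..3} \<subseteq> ecolor ` incident_edges ?G x"
    proof
      fix k :: nat assume "k \<in> {1..3}"
      then have "card {e \<in> incident_edges ?G x. ecolor e = k} \<noteq> 0"
        using color_degree_bounds(1)[of x n k] x
        unfolding color_degree_eq_card by (simp add: Tr_def)
      then have "{e \<in> incident_edges ?G x. ecolor e = k} \<noteq> {}"
        by (metis card.empty)
      then show "k \<in> ecolor ` incident_edges ?G x" by blast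
    qed
  qed
  moreover have "card {e \<in> incident_edges ?G x. ecolor e = k} \<le> 2 ^ n" if x: "x \<in> verts ?G" for x k
  proof (cases "k \<in> {1..3}")
    case True
    then show ?thesis
      using color_degree_bounds(2)[of x n k] x
      unfolding color_degree_eq_card by (simp add: Tr_def)
  next
    case False
    then have "{e \<in> incident_edges ?G x. ecolor e = k} = {}" using range by blast
    then show ?thesis by (metis card.empty le0)
  qed
  ultimately show ?thesis
    unfolding k_improper_interval_coloring_def improper_interval_coloring_def by blast
qed

section \<open>The maximum degree\<close>

lemma tr_verts_mono: "m \<le> n \<Longrightarrow> tr_verts m \<subseteq> tr_verts n"
  by (induction n rule: dec_induct) auto

lemma degree_Suc:
  assumes "x \<in> tr_verts n"
  shows "degree (Tr (Suc n)) x = degree (Tr n) x + face_degree n x"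
proof -
  have deg: "degree (Tr m) x = (\<Sum>e\<in>tr_edges m. of_bool (x \<in> e))" for m
    by (simp add: degree_def incident_edges_def Tr_def finite_tr_edges Int_def)
  have "of_bool (x \<in> {a, v}) + of_bool (x \<in> {b, v}) + of_bool (x \<in> {c, v})
      = (of_bool (x \<in> {a, b, c}) :: nat)"
    if f: "(a, b, c) \<in> tr_faces n" and v: "v = Center a b c" for a b c v
    using tr_face_distinct[OF f] tr_center_fresh[OF f] assms v by auto
  then show ?thesis
    unfolding deg face_degree_def sum_tr_edges_Suc
    by (auto intro!: sum.cong)
qed

lemma first_center_degree:
  assumes "x = Center (Corner 0) (Corner 1) (Corner 2)"
  shows "degree (Tr (Suc n)) x = 3 * 2 ^ n \<and> face_degree (Suc n) x = 3 * 2 ^ n"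
proof (induction n)
  case 0
  have "incident_edges (Tr (Suc 0)) x = {{Corner 0, x}, {Corner 1, x}, {Corner 2, x}}"
    using assms by (auto simp: incident_edges_def Tr_def)
  moreover have "card {{Corner 0, x}, {Corner 1, x}, {Corner 2, x}} = 3"
    by (auto simp: card_insert_if doubleton_eq_iff)
  ultimately show ?case
    using new_vertex_degrees(3)[of "Corner 0" "Corner 1" "Corner 2" 0 x 1] assms
    by (simp add: degree_def)
next
  case (Suc n)
  have "x \<in> tr_verts (Suc n)"
    using tr_verts_mono[of 1 "Suc n"] assms by auto
  from degree_Suc[OF this] face_degree_Suc[OF this] Suc.IH show ?case by simp
qed

lemma max_degree_Tr_ge: "3 * 2 ^ n \<le> max_degree (Tr (Suc n))"
proof -
  let ?x = "Center (Corner 0) (Corner 1) (Corner 2)"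
  have "?x \<in> tr_verts (Suc n)"
    using tr_verts_mono[of 1 "Suc n"] by auto
  then have "degree (Tr (Suc n)) ?x \<le> max_degree (Tr (Suc n))"
    unfolding max_degree_def using finite_tr_verts[of "Suc n"]
    by (intro Max_ge finite_imageI imageI) (simp_all add: Tr_def)
  then show ?thesis
    using first_center_degree[OF refl] by simp
qed

theorem theorem16:
  fixes n :: nat
  assumes "n \<ge> 1"
  shows "int (mu_int (Tr n)) \<le> \<lceil>real (max_degree (Tr n)) / 3\<rceil>"
proof -
  obtain m where n: "n = Suc m" using assms by (cases n) auto
  have "mu_int (Tr n) \<le> 2 ^ m"
    unfolding mu_int_def n using k_improper_ecolor[of m] by (intro Least_le) auto
  then have "3 * mu_int (Tr n) \<le> max_degree (Tr n)"
    using max_degree_Tr_ge[of m] unfolding n by linarith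
  then have "real (mu_int (Tr n)) \<le> real (max_degree (Tr n)) / 3"
    by simp
  then show ?thesis by linarith
qed

end
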